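(* Let $t\ge2$ be an integer and put $s=\lceil t/2\rceil$. Then the set $(2^s\mathbb{L}_{2^t})\setminus\{0\}$ induces a complete subgraph of $G_{2^t}$. Consequently, $$\omega(G_{2^t})\ge c_t:=|2^s\mathbb{L}_{2^t}|-1=2^{4(t-s)}-1=2^{4\lfloor t/2\rfloor}-1,$$ and, after a suitable permutation of the vertices, the adjacency matrix $A_{2^t}=A(G_{2^t})$ has the form $$\begin{pmatrix}\mathbf{J}_{c_t}-\mathbf{I}_{c_t}&*\\ *&*\end{pmatrix}.$$
   Context: For $n\ge2$, $\mathbb{L}_n=\{a+bi+cj+dk: a,b,c,d\in\mathbb{Z}/n\mathbb{Z}\}$ is the ring of Lipschitz quaternions modulo $n$, with the usual relations $i^2=j^2=k^2=-1$, $ij=k=-ji$, $jk=i=-kj$, $ki=j=-ik$ taken modulo $n$. A nonzero element $x$ of a ring is a zero divisor if $xy=0$ or $yx=0$ for some nonzero $y$. $G_n=\Gamma(\mathbb{L}_n)$ is the simple undirected graph whose vertices are the nonzero zero divisors of $\mathbb{L}_n$, distinct $x,y$ being adjacent iff $xy=0$ or $yx=0$; $A(G_n)$ is its adjacency matrix. $\omega$ is the clique number; $\mathbf{J}_m$ and $\mathbf{I}_m$ are the all-ones and identity matrices of order $m$. *)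

theory Defs
  imports
    "HOL-Number_Theory.Residues"
    "HOL-Combinatorics.Permutations"
    "Graph_Theory.Kuratowski"
    "Jordan_Normal_Form.Matrix"
begin

text \<open>
  Quaternions with coefficients in a ring \<open>R\<close>; the tuple \<open>(a, b, c, d)\<close> stands for
  \<open>a + b i + c j + d k\<close>, and the product is the bilinear extension of
  \<open>i\<^sup>2 = j\<^sup>2 = k\<^sup>2 = -1\<close>, \<open>i j = k = - j i\<close>, \<open>j k = i = - k j\<close>, \<open>k i = j = - i k\<close>.
\<close>

definition quaternion_ring ::
  "('a, 'm) ring_scheme \<Rightarrow> ('a \<times> 'a \<times> 'a \<times> 'a) ring" where
  "quaternion_ring R =
    \<lparr>carrier = carrier R \<times> carrier R \<times> carrier R \<times> carrier R,
     monoid.mult = (\<lambda>(a, b, c, d) (a', b', c', d').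
       (a \<otimes>\<^bsub>R\<^esub> a' \<ominus>\<^bsub>R\<^esub> b \<otimes>\<^bsub>R\<^esub> b' \<ominus>\<^bsub>R\<^esub> c \<otimes>\<^bsub>R\<^esub> c' \<ominus>\<^bsub>R\<^esub> d \<otimes>\<^bsub>R\<^esub> d',
        a \<otimes>\<^bsub>R\<^esub> b' \<oplus>\<^bsub>R\<^esub> b \<otimes>\<^bsub>R\<^esub> a' \<oplus>\<^bsub>R\<^esub> c \<otimes>\<^bsub>R\<^esub> d' \<ominus>\<^bsub>R\<^esub> d \<otimes>\<^bsub>R\<^esub> c',
        a \<otimes>\<^bsub>R\<^esub> c' \<ominus>\<^bsub>R\<^esub> b \<otimes>\<^bsub>R\<^esub> d' \<oplus>\<^bsub>R\<^esub> c \<otimes>\<^bsub>R\<^esub> a' \<oplus>\<^bsub>R\<^esub> d \<otimes>\<^bsub>R\<^esub> b',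
        a \<otimes>\<^bsub>R\<^esub> d' \<oplus>\<^bsub>R\<^esub> b \<otimes>\<^bsub>R\<^esub> c' \<ominus>\<^bsub>R\<^esub> c \<otimes>\<^bsub>R\<^esub> b' \<oplus>\<^bsub>R\<^esub> d \<otimes>\<^bsub>R\<^esub> a')),
     one = (\<one>\<^bsub>R\<^esub>, \<zero>\<^bsub>R\<^esub>, \<zero>\<^bsub>R\<^esub>, \<zero>\<^bsub>R\<^esub>),
     zero = (\<zero>\<^bsub>R\<^esub>, \<zero>\<^bsub>R\<^esub>, \<zero>\<^bsub>R\<^esub>, \<zero>\<^bsub>R\<^esub>),
     add = (\<lambda>(a, b, c, d) (a', b', c', d').
       (a \<oplus>\<^bsub>R\<^esub> a', b \<oplus>\<^bsub>R\<^esub> b', c \<oplus>\<^bsub>R\<^esub> c', d \<oplus>\<^bsub>R\<^esub> d'))\<rparr>"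

definition lipschitz_ring :: "nat \<Rightarrow> (int \<times> int \<times> int \<times> int) ring" where
  "lipschitz_ring n = quaternion_ring (residue_ring (int n))"

definition zero_divisors :: "('a, 'm) ring_scheme \<Rightarrow> 'a set" where
  "zero_divisors R =
    {x \<in> carrier R - {\<zero>\<^bsub>R\<^esub>}.
      \<exists>y \<in> carrier R - {\<zero>\<^bsub>R\<^esub>}. x \<otimes>\<^bsub>R\<^esub> y = \<zero>\<^bsub>R\<^esub> \<or> y \<otimes>\<^bsub>R\<^esub> x = \<zero>\<^bsub>R\<^esub>}"

text \<open>
  Simple undirected graphs are encoded as in the locale \<^locale>\<open>graph\<close>: loop-free
  digraphs with a symmetric set of arcs and no parallel arcs.
\<close>

definition zero_divisor_graph :: "('a, 'm) ring_scheme \<Rightarrow> ('a, 'a \<times> 'a) pre_digraph" where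
  "zero_divisor_graph R = with_proj
    \<lparr>pverts = zero_divisors R,
     parcs = {(x, y) \<in> zero_divisors R \<times> zero_divisors R.
       x \<noteq> y \<and> (x \<otimes>\<^bsub>R\<^esub> y = \<zero>\<^bsub>R\<^esub> \<or> y \<otimes>\<^bsub>R\<^esub> x = \<zero>\<^bsub>R\<^esub>)}\<rparr>"

text \<open>The first conjunct is needed because \<open>G \<restriction> S\<close> has vertex set \<open>S\<close> for every \<open>S\<close>.\<close>

definition induces_complete :: "('a, 'b) pre_digraph \<Rightarrow> 'a set \<Rightarrow> bool" where
  "induces_complete G S \<longleftrightarrow> S \<subseteq> verts G \<and> K\<^bsub>card S\<^esub> (G \<restriction> S)"

definition clique_number :: "('a, 'b) pre_digraph \<Rightarrow> nat" where
  "clique_number G = Max {card S |S. induces_complete G S}"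

text \<open>The list \<open>vs\<close> fixes the order of the vertices.\<close>

definition adjacency_matrix :: "('a, 'b) pre_digraph \<Rightarrow> 'a list \<Rightarrow> real mat" where
  "adjacency_matrix G vs =
    mat (length vs) (length vs) (\<lambda>(i, j). if vs ! i \<rightarrow>\<^bsub>G\<^esub> vs ! j then 1 else 0)"

definition all_ones_mat :: "nat \<Rightarrow> real mat" where
  "all_ones_mat m = mat m m (\<lambda>_. 1)"

lemma ring_quaternion_ring:
  fixes R (structure)
  assumes "cring R"
  shows "ring (quaternion_ring R)"
proof -
  interpret cring R by fact
  show ?thesis
  proof (rule ringI)
    show "abelian_group (quaternion_ring R)"
    proof (rule abelian_groupI)
      fix x assume "x \<in> carrier (quaternion_ring R)"
      then obtain a b c d where x: "x = (a, b, c, d)"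
        and [simp]: "a \<in> carrier R" "b \<in> carrier R" "c \<in> carrier R" "d \<in> carrier R"
        by (auto simp: quaternion_ring_def)
      show "\<exists>y\<in>carrier (quaternion_ring R). y \<oplus>\<^bsub>quaternion_ring R\<^esub> x = \<zero>\<^bsub>quaternion_ring R\<^esub>"
        by (rule bexI[of _ "(\<ominus> a, \<ominus> b, \<ominus> c, \<ominus> d)"])
          (auto simp: quaternion_ring_def x l_neg)
    qed (auto simp: quaternion_ring_def a_ac)
    show "monoid (quaternion_ring R)"
      by (rule monoidI) (auto simp: quaternion_ring_def minus_eq l_distr r_distr l_minus r_minus minus_add a_ac m_ac)
  qed (auto simp: quaternion_ring_def minus_eq l_distr r_distr l_minus r_minus minus_add a_ac m_ac)
qed

lemma quaternion_ring_relations: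
  fixes R (structure)
  assumes "cring R"
  defines "Q \<equiv> quaternion_ring R"
    and "i \<equiv> (\<zero>, \<one>, \<zero>, \<zero>)" and "j \<equiv> (\<zero>, \<zero>, \<one>, \<zero>)" and "k \<equiv> (\<zero>, \<zero>, \<zero>, \<one>)"
  shows "i \<otimes>\<^bsub>Q\<^esub> i = (\<ominus> \<one>, \<zero>, \<zero>, \<zero>)" "j \<otimes>\<^bsub>Q\<^esub> j = (\<ominus> \<one>, \<zero>, \<zero>, \<zero>)"
    "k \<otimes>\<^bsub>Q\<^esub> k = (\<ominus> \<one>, \<zero>, \<zero>, \<zero>)"
    "i \<otimes>\<^bsub>Q\<^esub> j = k" "j \<otimes>\<^bsub>Q\<^esub> i = (\<zero>, \<zero>, \<zero>, \<ominus> \<one>)"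
    "j \<otimes>\<^bsub>Q\<^esub> k = i" "k \<otimes>\<^bsub>Q\<^esub> j = (\<zero>, \<ominus> \<one>, \<zero>, \<zero>)"
    "k \<otimes>\<^bsub>Q\<^esub> i = j" "i \<otimes>\<^bsub>Q\<^esub> k = (\<zero>, \<zero>, \<ominus> \<one>, \<zero>)"
proof -
  interpret cring R by fact
  show "i \<otimes>\<^bsub>Q\<^esub> i = (\<ominus> \<one>, \<zero>, \<zero>, \<zero>)" "j \<otimes>\<^bsub>Q\<^esub> j = (\<ominus> \<one>, \<zero>, \<zero>, \<zero>)"
    "k \<otimes>\<^bsub>Q\<^esub> k = (\<ominus> \<one>, \<zero>, \<zero>, \<zero>)"
    "i \<otimes>\<^bsub>Q\<^esub> j = k" "j \<otimes>\<^bsub>Q\<^esub> i = (\<zero>, \<zero>, \<zero>, \<ominus> \<one>)"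
    "j \<otimes>\<^bsub>Q\<^esub> k = i" "k \<otimes>\<^bsub>Q\<^esub> j = (\<zero>, \<ominus> \<one>, \<zero>, \<zero>)"
    "k \<otimes>\<^bsub>Q\<^esub> i = j" "i \<otimes>\<^bsub>Q\<^esub> k = (\<zero>, \<zero>, \<ominus> \<one>, \<zero>)"
    by (auto simp: Q_def quaternion_ring_def i_def j_def k_def minus_eq)
qed

lemma ring_lipschitz_ring:
  assumes "n \<ge> 2"
  shows "ring (lipschitz_ring n)"
proof -
  interpret residues "int n" "residue_ring (int n)"
    using assms by unfold_locales auto
  show ?thesis
    unfolding lipschitz_ring_def by (rule ring_quaternion_ring) (rule is_cring)
qed

lemma graph_zero_divisor_graph:
  assumes "finite (carrier R)"
  shows "graph (zero_divisor_graph R)"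
proof -
  have "finite (zero_divisors R)"
    using assms by (simp add: zero_divisors_def)
  then have "pair_graph
    \<lparr>pverts = zero_divisors R,
     parcs = {(x, y) \<in> zero_divisors R \<times> zero_divisors R.
       x \<noteq> y \<and> (x \<otimes>\<^bsub>R\<^esub> y = \<zero>\<^bsub>R\<^esub> \<or> y \<otimes>\<^bsub>R\<^esub> x = \<zero>\<^bsub>R\<^esub>)}\<rparr>"
    by unfold_locales
      (auto simp: symmetric_def intro!: symI intro: finite_subset[of _ "zero_divisors R \<times> zero_divisors R"])
  then show ?thesis
    unfolding zero_divisor_graph_def by (rule pair_graph.pair_graphD_graph)
qed

end

theory Submission
  imports Defs
begin

text \<open>
  Put \<open>q = 2\<^sup>s\<close>. As \<open>s = \<lceil>t/2\<rceil>\<close>, the modulus \<open>2\<^sup>t\<close> divides \<open>q\<^sup>2 = 2\<^sup>2\<^sup>s\<close>. Integer multiples move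
  freely through products, so \<open>(q x) (q y) = q\<^sup>2 (x y) = 0\<close> for all quaternions \<open>x\<close> and \<open>y\<close> modulo
  \<open>2\<^sup>t\<close>: any two elements of \<open>M = q \<L>\<close> annihilate each other (\<open>add_pow_mult_add_pow_eq_zero\<close>).
  In particular every element of \<open>M\<close> squares to zero. Hence each nonzero one is a zero divisor, that
  is, a vertex, and any two distinct ones are adjacent
  (\<open>induces_complete_zero_divisor_graph\<close>).

  For the size of this clique, multiplication by \<open>q\<close> acts separately on the four coordinates, and
  the multiples of \<open>q\<close> modulo \<open>2\<^sup>t = q 2\<^sup>t\<^sup>-\<^sup>s\<close> are \<open>q j\<close> for \<open>0 \<le> j < 2\<^sup>t\<^sup>-\<^sup>s\<close>; so \<open>M\<close> has
  \<open>(2\<^sup>t\<^sup>-\<^sup>s)\<^sup>4\<close> elements (\<open>card_add_pow_lipschitz_ring\<close>).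

  The bound on the clique number and the block form of the adjacency matrix follow from the presence
  of the clique alone: its size is at most the maximal size, and listing its vertices first puts a block with
  zeros on the diagonal and ones elsewhere in the upper left corner
  (\<open>adjacency_matrix_clique_block\<close>).
\<close>

lemma induces_complete_adjacent_iff:
  assumes "induces_complete G S" "u \<in> S" "v \<in> S"
  shows "u \<rightarrow>\<^bsub>G\<^esub> v \<longleftrightarrow> u \<noteq> v"
proof -
  have "arcs_ends (G \<restriction> S) = {(u, v). (u, v) \<in> S \<times> S \<and> u \<noteq> v}"
    using assms(1) by (simp add: induces_complete_def complete_digraph_def)
  moreover have "arcs_ends (G \<restriction> S) = arcs_ends G \<inter> S \<times> S"
    by (auto simp: arcs_ends_conv induce_subgraph_def)
  ultimately show ?thesis
    using assms(2,3) by blast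
qed

text \<open>Finiteness makes the maximum that defines the clique number a genuine upper bound.\<close>

lemma card_le_clique_number:
  assumes "finite (verts G)" "induces_complete G S"
  shows "card S \<le> clique_number G"
proof -
  have "{card S |S. induces_complete G S} \<subseteq> card ` Pow (verts G)"
    by (auto simp: induces_complete_def)
  then have "finite {card S |S. induces_complete G S}"
    using assms(1) by (simp add: finite_subset)
  then show ?thesis
    unfolding clique_number_def using assms(2) by (auto intro: Max_ge)
qed

text \<open>
  Stable partition of the vertex list into members and non-members of the clique is a permutation
  that moves the clique to the front.
\<close>

lemma adjacency_matrix_clique_block:
  assumes clique: "induces_complete G S" and vs: "distinct vs" "set vs = verts G"
  defines "c \<equiv> card S"
  shows "\<exists>p. p permutes {..<length vs} \<and>
    (\<exists>B \<in> carrier_mat c (length vs - c).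
     \<exists>C \<in> carrier_mat (length vs - c) c.
     \<exists>D \<in> carrier_mat (length vs - c) (length vs - c).
       adjacency_matrix G (permute_list p vs) =
         four_block_mat (all_ones_mat c - 1\<^sub>m c) B C D)"
proof -
  define xs where "xs = filter (\<lambda>v. v \<in> S) vs"
  define ws where "ws = xs @ filter (\<lambda>v. v \<notin> S) vs"
  have "mset ws = mset vs"
    by (simp add: ws_def xs_def)
  then obtain p where p: "p permutes {..<length vs}" "permute_list p vs = ws"
    by (rule mset_eq_permutation)
  have len: "length ws = length vs"
    using \<open>mset ws = mset vs\<close> by (rule mset_eq_length)
  have xs: "set xs = S" "distinct xs"
    using clique vs by (auto simp: xs_def induces_complete_def)
  then have len_xs: "length xs = c"
    by (metis c_def distinct_card)
  then have c_le: "c \<le> length vs"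
    by (metis length_filter_le xs_def)
  have corner: "ws ! i \<rightarrow>\<^bsub>G\<^esub> ws ! j \<longleftrightarrow> i \<noteq> j" if "i < c" "j < c" for i j
  proof -
    have "ws ! i = xs ! i" "ws ! j = xs ! j"
      using that len_xs by (simp_all add: ws_def nth_append)
    moreover have "xs ! i \<in> S" "xs ! j \<in> S"
      using that len_xs xs(1) nth_mem by blast+
    ultimately show ?thesis
      using that len_xs induces_complete_adjacent_iff[OF clique] nth_eq_iff_index_eq[OF xs(2)]
      by simp
  qed
  let ?A = "adjacency_matrix G ws" and ?d = "length vs - c"
  let ?B = "mat c ?d (\<lambda>(i, j). ?A $$ (i, j + c))"
  let ?C = "mat ?d c (\<lambda>(i, j). ?A $$ (i + c, j))"
  let ?D = "mat ?d ?d (\<lambda>(i, j). ?A $$ (i + c, j + c))"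
  have "?A = four_block_mat (all_ones_mat c - 1\<^sub>m c) ?B ?C ?D"
    using c_le len corner
    by (intro eq_matI) (auto simp: adjacency_matrix_def all_ones_mat_def)
  then have "\<exists>D \<in> carrier_mat ?d ?d. ?A = four_block_mat (all_ones_mat c - 1\<^sub>m c) ?B ?C D"
    by (rule bexI) (rule mat_carrier)
  then have "\<exists>C \<in> carrier_mat ?d c. \<exists>D \<in> carrier_mat ?d ?d.
      ?A = four_block_mat (all_ones_mat c - 1\<^sub>m c) ?B C D"
    by (rule bexI) (rule mat_carrier)
  then have "\<exists>B \<in> carrier_mat c ?d. \<exists>C \<in> carrier_mat ?d c. \<exists>D \<in> carrier_mat ?d ?d.
      ?A = four_block_mat (all_ones_mat c - 1\<^sub>m c) B C D"
    by (rule bexI) (rule mat_carrier)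
  with p show ?thesis
    by blast
qed

text \<open>
  The products \<open>x \<otimes> x\<close> are included in the hypothesis, so that a nonzero element is a zero divisor
  even if it is the only one in \<open>S\<close>.
\<close>

lemma induces_complete_zero_divisor_graph:
  assumes "finite S" "S \<subseteq> carrier R"
    and mult_zero: "\<And>x y. x \<in> S \<Longrightarrow> y \<in> S \<Longrightarrow> x \<otimes>\<^bsub>R\<^esub> y = \<zero>\<^bsub>R\<^esub>"
  shows "induces_complete (zero_divisor_graph R) (S - {\<zero>\<^bsub>R\<^esub>})"
proof -
  let ?T = "S - {\<zero>\<^bsub>R\<^esub>}"
  have T: "?T \<subseteq> zero_divisors R"
    using assms by (fastforce simp: zero_divisors_def)
  have "zero_divisor_graph R \<restriction> ?T =
    with_proj \<lparr>pverts = ?T, parcs = {(x, y). (x, y) \<in> ?T \<times> ?T \<and> x \<noteq> y}\<rparr>"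
    using T mult_zero by (auto simp: induce_subgraph_def zero_divisor_graph_def with_proj_def)
  then have "K\<^bsub>card ?T\<^esub> (zero_divisor_graph R \<restriction> ?T)"
    using \<open>finite S\<close> by (simp add: complete_digraph_pair_def)
  then show ?thesis
    using T by (simp add: induces_complete_def zero_divisor_graph_def)
qed

lemma (in ring) add_pow_mult_add_pow_eq_zero:
  fixes n :: nat
  assumes "\<And>z. z \<in> carrier R \<Longrightarrow> [(n * n)] \<cdot> z = \<zero>" "x \<in> carrier R" "y \<in> carrier R"
  shows "[n] \<cdot> x \<otimes> [n] \<cdot> y = \<zero>"
proof -
  have "[n] \<cdot> x \<otimes> [n] \<cdot> y = [(n * n)] \<cdot> (x \<otimes> y)"
    using assms(2,3) by (simp add: add_pow_ldistr add_pow_rdistr add.nat_pow_pow)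
  then show ?thesis
    using assms by simp
qed

lemma carrier_lipschitz_ring:
  "carrier (lipschitz_ring n) = {0..<int n} \<times> {0..<int n} \<times> {0..<int n} \<times> {0..<int n}"
  by (auto simp: lipschitz_ring_def quaternion_ring_def residue_ring_def)

lemma zero_lipschitz_ring: "\<zero>\<^bsub>lipschitz_ring n\<^esub> = (0, 0, 0, 0)"
  by (simp add: lipschitz_ring_def quaternion_ring_def residue_ring_def)

lemma add_lipschitz_ring:
  "(a, b, c, d) \<oplus>\<^bsub>lipschitz_ring n\<^esub> (a', b', c', d') =
    ((a + a') mod int n, (b + b') mod int n, (c + c') mod int n, (d + d') mod int n)"
  by (simp add: lipschitz_ring_def quaternion_ring_def residue_ring_def)

lemma add_pow_lipschitz_ring:
  "[k] \<cdot>\<^bsub>lipschitz_ring n\<^esub> (a, b, c, d) =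
    (int k * a mod int n, int k * b mod int n, int k * c mod int n, int k * d mod int n)"
proof (induction k)
  case 0
  then show ?case
    by (simp add: add_pow_def zero_lipschitz_ring)
next
  case (Suc k)
  have "[(Suc k)] \<cdot>\<^bsub>lipschitz_ring n\<^esub> (a, b, c, d) =
      [k] \<cdot>\<^bsub>lipschitz_ring n\<^esub> (a, b, c, d) \<oplus>\<^bsub>lipschitz_ring n\<^esub> (a, b, c, d)"
    by (simp add: add_pow_def)
  then show ?case
    unfolding Suc add_lipschitz_ring by (simp add: mod_simps algebra_simps)
qed

lemma add_pow_lipschitz_ring_eq_zero:
  assumes "n dvd k"
  shows "[k] \<cdot>\<^bsub>lipschitz_ring n\<^esub> z = \<zero>\<^bsub>lipschitz_ring n\<^esub>"
  using assms by (cases z) (simp add: add_pow_lipschitz_ring zero_lipschitz_ring)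

text \<open>The point is that \<open>k a mod k m = k (a mod m)\<close>, and \<open>a mod m\<close> takes every value in \<open>[0, m)\<close>.\<close>

lemma multiples_mod_eq:
  fixes k m :: nat
  assumes "0 < k" "0 < m"
  shows "(\<lambda>a. int k * a mod int (k * m)) ` {0..<int (k * m)} = (*) (int k) ` {0..<int m}"
proof -
  have "(\<lambda>a. a mod int m) ` {0..<int (k * m)} = {0..<int m}"
  proof (intro equalityI subsetI)
    fix a assume a: "a \<in> {0..<int m}"
    have "m \<le> k * m"
      using assms(1) by simp
    then have "int m \<le> int (k * m)"
      by (rule of_nat_mono)
    then have "{0..<int m} \<subseteq> {0..<int (k * m)}"
      by (intro ivl_subset[THEN iffD2]) (simp del: of_nat_mult)
    then have "a \<in> {0..<int (k * m)}"
      using a by (rule subsetD)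
    then show "a \<in> (\<lambda>a. a mod int m) ` {0..<int (k * m)}"
      by (rule rev_image_eqI) (use a in simp)
  qed (use assms(2) in auto)
  moreover have "(\<lambda>a. int k * a mod int (k * m)) = (*) (int k) \<circ> (\<lambda>a. a mod int m)"
    by (rule ext) (simp only: o_apply of_nat_mult mult_mod_right)
  ultimately show ?thesis
    by (metis image_comp)
qed

lemma card_add_pow_lipschitz_ring:
  fixes k m :: nat
  assumes "0 < k" "0 < m"
  shows "card (add_pow (lipschitz_ring (k * m)) k ` carrier (lipschitz_ring (k * m))) = m ^ 4"
proof -
  let ?N = "{0..<int (k * m)}" and ?f = "\<lambda>a. int k * a mod int (k * m)"
  have "add_pow (lipschitz_ring (k * m)) k =
    map_prod ?f (map_prod ?f (map_prod ?f ?f))"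
    by (auto simp: fun_eq_iff add_pow_lipschitz_ring)
  then have image: "add_pow (lipschitz_ring (k * m)) k ` carrier (lipschitz_ring (k * m)) =
    ?f ` ?N \<times> ?f ` ?N \<times> ?f ` ?N \<times> ?f ` ?N"
    by (simp add: carrier_lipschitz_ring map_prod_surj_on)
  have "inj_on ((*) (int k)) {0..<int m}"
    using assms by (auto intro: inj_onI)
  then have "card (?f ` ?N) = m"
    unfolding multiples_mod_eq[OF assms] by (simp add: card_image)
  then show ?thesis
    unfolding image card_cartesian_product by (simp add: eval_nat_numeral)
qed

theorem theorem5p3:
  fixes t s c :: nat
    and L :: "(int \<times> int \<times> int \<times> int) ring"
    and G :: "(int \<times> int \<times> int \<times> int, (int \<times> int \<times> int \<times> int) \<times> (int \<times> int \<times> int \<times> int)) pre_digraph"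
    and M :: "(int \<times> int \<times> int \<times> int) set"
  assumes "t \<ge> 2"
    and "s = nat \<lceil>real t / 2\<rceil>"
    and "L = lipschitz_ring (2 ^ t)"
    and "G = zero_divisor_graph L"
    and "M = add_pow L ((2::nat) ^ s) ` carrier L"
    and "c = card M - 1"
  shows "induces_complete G (M - {\<zero>\<^bsub>L\<^esub>})
    \<and> c = 2 ^ (4 * (t - s)) - 1
    \<and> c = 2 ^ (4 * nat \<lfloor>real t / 2\<rfloor>) - 1
    \<and> clique_number G \<ge> c
    \<and> (\<forall>vs. distinct vs \<and> set vs = verts G \<longrightarrow>
        (\<exists>p. p permutes {..<length vs} \<and>
          (\<exists>B \<in> carrier_mat c (length vs - c).
           \<exists>C \<in> carrier_mat (length vs - c) c.
           \<exists>D \<in> carrier_mat (length vs - c) (length vs - c).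
             adjacency_matrix G (permute_list p vs) =
               four_block_mat (all_ones_mat c - 1\<^sub>m c) B C D)))"
proof -
  have s: "s = (t + 1) div 2"
    unfolding assms(2) by linarith
  have floor: "nat \<lfloor>real t / 2\<rfloor> = t - s"
    unfolding s by linarith
  have N: "(2::nat) ^ t = 2 ^ s * 2 ^ (t - s)" and "(2::nat) ^ t dvd 2 ^ s * 2 ^ s"
    using s by (simp_all add: le_imp_power_dvd flip: power_add)
  have "(2::nat) \<le> 2 ^ t"
    using assms(1) by (simp add: self_le_power)
  then interpret L: ring L
    unfolding assms(3) by (rule ring_lipschitz_ring)
  have fin: "finite (carrier L)"
    by (simp add: assms(3) carrier_lipschitz_ring)
  have M: "finite M" "M \<subseteq> carrier L"
    using fin by (auto simp: assms(5))
  have "\<zero>\<^bsub>L\<^esub> \<in> M"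
    unfolding assms(5) by (rule image_eqI[of _ _ "\<zero>\<^bsub>L\<^esub>"]) simp_all
  then have c: "card (M - {\<zero>\<^bsub>L\<^esub>}) = c"
    by (simp add: assms(6))
  have "card M = (2 ^ (t - s)) ^ 4"
    unfolding assms(5) assms(3) N by (rule card_add_pow_lipschitz_ring) simp_all
  then have card: "c = 2 ^ (4 * (t - s)) - 1"
    unfolding assms(6) by (simp add: mult.commute flip: power_mult)
  have "[((2::nat) ^ s * 2 ^ s)] \<cdot>\<^bsub>L\<^esub> z = \<zero>\<^bsub>L\<^esub>" for z
    unfolding assms(3) by (rule add_pow_lipschitz_ring_eq_zero) fact
  then have "x \<otimes>\<^bsub>L\<^esub> y = \<zero>\<^bsub>L\<^esub>" if "x \<in> M" "y \<in> M" for x y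
    using that by (auto simp: assms(5) intro: L.add_pow_mult_add_pow_eq_zero)
  then have clique: "induces_complete G (M - {\<zero>\<^bsub>L\<^esub>})"
    unfolding assms(4) using M by (intro induces_complete_zero_divisor_graph)
  have "finite (verts G)"
    using fin by (simp add: assms(4) zero_divisor_graph_def zero_divisors_def)
  then have "c \<le> clique_number G"
    using card_le_clique_number[OF _ clique] c by simp
  then show ?thesis
    using clique card floor adjacency_matrix_clique_block[OF clique, unfolded c] by simp
qed

end
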